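(* Let $n \geq 9$ be an integer that is not prime. Then there exists a nut graph $G$ of order $n$ with $o_v(G) = 2$.
   Context: A nut graph is a simple connected graph whose adjacency matrix has one-dimensional kernel spanned by a vector with no zero entry. $o_v(G)$ is the number of orbits of the full automorphism group $\mathrm{Aut}(G)$ on $V(G)$. *)

theory Defs
  imports
    "Graph_Theory.Graph_Theory"
    "Jordan_Normal_Form.Matrix_Kernel"
    "HOL-Algebra.Bij"
    "HOL-Algebra.Group_Action"
    "HOL-Computational_Algebra.Primes"
begin

text \<open>
  A finite simple graph is a \<^locale>\<open>pair_graph\<close>: finite, loop-free, with a symmetric set of arcs
  represented as ordered pairs of vertices.
\<close>

text \<open>Rows and columns are indexed by the vertices in increasing order.\<close>

definition adjacency_matrix :: "'a::linorder pair_pre_digraph \<Rightarrow> real mat" where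
  "adjacency_matrix G =
    (let vs = sorted_list_of_set (pverts G); n = card (pverts G)
     in mat n n (\<lambda>(i, j). if (vs ! i, vs ! j) \<in> parcs G then 1 else 0))"

definition nut_graph :: "'a::linorder pair_pre_digraph \<Rightarrow> bool" where
  "nut_graph G \<longleftrightarrow>
    pair_graph G \<and> Digraph_Component.connected (with_proj G) \<and>
    kernel_dim (adjacency_matrix G) = 1 \<and>
    (\<exists>x \<in> mat_kernel (adjacency_matrix G).
       kernel.span (card (pverts G)) (adjacency_matrix G) {x} = mat_kernel (adjacency_matrix G) \<and>
       (\<forall>i < card (pverts G). x $ i \<noteq> 0))"

text \<open>
  The full automorphism group as a subgroup of the symmetric group on the vertex set
  (elements of \<^const>\<open>BijGroup\<close> are \<^const>\<open>undefined\<close> outside the vertex set).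
\<close>

definition Aut :: "'a pair_pre_digraph \<Rightarrow> ('a \<Rightarrow> 'a) monoid" where
  "Aut G = (BijGroup (pverts G))
    \<lparr>carrier := {f \<in> Bij (pverts G).
       \<forall>u \<in> pverts G. \<forall>v \<in> pverts G. (f u, f v) \<in> parcs G \<longleftrightarrow> (u, v) \<in> parcs G}\<rparr>"

definition num_vertex_orbits :: "'a pair_pre_digraph \<Rightarrow> nat" where
  "num_vertex_orbits G = card (orbits (Aut G) (pverts G) (\<lambda>f. f))"

end

(*
  Two families cover all n.  If n = a b with 1 < b = 2t + 1 <= a, hang t triangles on every vertex of a
  connected circulant graph of degree 2t on a vertices.  A kernel vector takes the value -x on the
  outer vertices of the triangles at a vertex of value x, so on the circulant it is harmonic, hence
  constant.  The only other case is n = 2m with m >= 5 prime to 3.  There take u_i ~ u_(i+1),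
  w_i ~ w_(i+2), u_i ~ w_i and u_i ~ w_(i+1) with indices modulo m.  With T the shift by one,
  (T + 1/T)(T^2 + 1/T^2) - (1 + T)(1 + 1/T) = T^3 + 1/T^3 - 2, so kernel vectors are harmonic for
  steps of length 3 on u and on w, hence constant on each.  In both families rotations act
  transitively on the two classes of vertices, and a local property distinguishes the classes: in
  the first whether the neighbourhood is a clique, in the second whether every edge at the vertex
  lies in a triangle.
*)
theory Submission
  imports Defs "HOL-Number_Theory.Cong"
begin

section \<open>Criteria for nut graphs and for two vertex orbits\<close>

text \<open>On the vertex set \<open>{..<n}\<close> vertex and matrix index coincide, so
  \<open>?A *\<^sub>v x\<close> lists the neighbourhood sums of \<open>x\<close>. Then
  \<open>ker\<close> puts \<open>z\<close> into the kernel, \<open>uniq\<close> makes it span, and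
  \<open>nz\<close> makes it independent as well as nowhere zero.\<close>

lemma nut_graph_natI:
  fixes G :: "nat pair_pre_digraph"
  assumes graph: "pair_graph G" and V: "pverts G = {..<n}"
    and conn: "\<And>u v. u < n \<Longrightarrow> v < n \<Longrightarrow> (u, v) \<in> (parcs G)\<^sup>*"
    and n: "n > 0"
    and nz: "\<And>v. v < n \<Longrightarrow> z v \<noteq> 0"
    and ker: "\<And>u. u < n \<Longrightarrow> (\<Sum>v | (u, v) \<in> parcs G. z v) = 0"
    and uniq: "\<And>x :: nat \<Rightarrow> real. (\<And>u. u < n \<Longrightarrow> (\<Sum>v | (u, v) \<in> parcs G. x v) = 0) \<Longrightarrow>
      \<exists>c. \<forall>v<n. x v = c * z v"
  shows "nut_graph G"
proof -
  interpret pair_graph G by (fact graph)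
  let ?A = "adjacency_matrix G"
  have card: "card (pverts G) = n" by (simp add: V)
  have nth: "sorted_list_of_set (pverts G) ! i = i" if "i < n" for i
    using that by (simp add: V lessThan_atLeast0)
  have A_def: "?A = mat n n (\<lambda>(i, j). if (i, j) \<in> parcs G then 1 else 0)"
    unfolding adjacency_matrix_def Let_def card by (intro eq_matI) (auto simp: nth)
  have A: "?A \<in> carrier_mat n n" by (simp add: A_def)
  have mult: "(?A *\<^sub>v x) $ u = (\<Sum>v | (u, v) \<in> parcs G. x $ v)" if "u < n" "x \<in> carrier_vec n" for u x
  proof -
    have "(?A *\<^sub>v x) $ u = (\<Sum>v<n. if (u, v) \<in> parcs G then x $ v else 0)"
      using that by (auto simp: A_def scalar_prod_def lessThan_atLeast0 intro!: sum.cong)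
    also have "\<dots> = (\<Sum>v | v < n \<and> (u, v) \<in> parcs G. x $ v)"
      by (simp add: sum.If_cases Int_def)
    also have "{v. v < n \<and> (u, v) \<in> parcs G} = {v. (u, v) \<in> parcs G}"
      using in_arcsD2 V by auto
    finally show ?thesis .
  qed
  interpret kernel n n ?A by unfold_locales (fact A)
  define x where "x = vec n z"
  have x: "x \<in> carrier_vec n" "\<And>i. i < n \<Longrightarrow> x $ i = z i" by (auto simp: x_def)
  have sumz: "(\<Sum>v | (u, v) \<in> parcs G. x $ v) = (\<Sum>v | (u, v) \<in> parcs G. z v)" for u
    using in_arcsD2 V by (intro sum.cong) (auto simp: x)
  have xk: "x \<in> mat_kernel ?A"
    using x(1) A by (intro mat_kernelI[OF A]) (auto simp: mult sumz ker intro!: eq_vecI)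
  have gen: "span {x} = mat_kernel ?A"
  proof
    show "span {x} \<subseteq> mat_kernel ?A" using xk by (intro Ker.span_is_subset2) auto
    show "mat_kernel ?A \<subseteq> span {x}"
    proof
      fix y assume y: "y \<in> mat_kernel ?A"
      note yD = mat_kernelD[OF A y]
      have "(\<Sum>v | (u, v) \<in> parcs G. y $ v) = 0" if "u < n" for u
        using mult[OF that yD(1)] yD(2) that by simp
      then obtain c where "\<forall>v<n. y $ v = c * z v" using uniq[of "\<lambda>v. y $ v"] by blast
      then have "y = c \<cdot>\<^sub>v x" using yD(1) x by (intro eq_vecI) auto
      moreover have "lincomb (\<lambda>_. c) {x} = c \<cdot>\<^sub>v x"
        using xk x by (intro eq_vecI) (auto simp: lincomb_index Ker.lincomb_def)
      ultimately show "y \<in> span {x}"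
        by (auto simp: Ker.span_def intro!: exI[of _ "\<lambda>_. c"] exI[of _ "{x}"])
    qed
  qed
  have "x \<noteq> 0\<^sub>v n" using nz[OF n] n x(2)[OF n] by auto
  have indpt: "lin_indpt {x}"
  proof (rule Ker.finite_lin_indpt2)
    \<comment> \<open>Reading off coordinate 0 suffices, because \<open>z 0\<close> is
      nonzero.\<close>
    fix a assume "lincomb a {x} = 0\<^sub>v n"
    then have "a x * z 0 = 0"
      using lincomb_index[OF n, of "{x}" a] xk x(2)[OF n] n by simp
    then show "\<forall>v\<in>{x}. a v = 0" using nz[OF n] by simp
  qed (use xk in auto)
  have "Ker.basis {x}" using gen indpt xk by (simp add: Ker.basis_def)
  then have "dim = 1" using Ker.dim_basis[of "{x}"] by simp
  \<comment> \<open>Connectedness is reachability in the symmetric closure, which agrees with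
    reachability in \<open>G\<close> because the arcs are already symmetric.\<close>
  moreover have "Digraph_Component.connected (with_proj G)"
  proof -
    have "u \<rightarrow>\<^sup>*\<^bsub>with_proj G\<^esub> v" if "u < n" "v < n" for u v
      using conn[OF that]
    proof (induction rule: rtrancl_induct)
      case base
      then show ?case using that V by (simp add: reachable_def)
    next
      case (step y w)
      then show ?case using in_arcsD2 unfolding reachable_def
        by (auto intro: rtrancl_on_into_rtrancl_on)
    qed
    then show ?thesis
      using n V reachable_mk_symmetric_eq[OF pair_sym_arcs]
      by (auto simp: connected_def strongly_connected_def)
  qed
  ultimately show ?thesis
    unfolding nut_graph_def card
    using graph xk gen nz x A by (intro conjI bexI[of _ x]) auto
qed

text \<open>Values outside \<open>V\<close> are left free, so rotations and composites can be given
  as plain functions; elements of \<open>Aut G\<close> are \<open>undefined\<close> there.\<close>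

definition automorphism :: "'a set \<Rightarrow> 'a rel \<Rightarrow> ('a \<Rightarrow> 'a) \<Rightarrow> bool" where
  "automorphism V E f \<longleftrightarrow>
    bij_betw f V V \<and> (\<forall>u\<in>V. \<forall>v\<in>V. (f u, f v) \<in> E \<longleftrightarrow> (u, v) \<in> E)"

text \<open>Restricting an automorphism to the vertex set gives an element of \<open>Aut G\<close>
  with the same value at \<open>u\<close>.\<close>

lemma orbit_Aut:
  assumes "u \<in> pverts G"
  shows "orbit (Aut G) (\<lambda>f. f) u = {f u | f. automorphism (pverts G) (parcs G) f}"
proof -
  have "\<exists>g\<in>carrier (Aut G). g u = f u" if f: "automorphism (pverts G) (parcs G) f" for f
  proof (rule bexI[of _ "restrict f (pverts G)"])
    have "bij_betw (restrict f (pverts G)) (pverts G) (pverts G)"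
      using f by (simp add: automorphism_def cong: bij_betw_cong)
    then show "restrict f (pverts G) \<in> carrier (Aut G)"
      using f by (auto simp: Aut_def Bij_def automorphism_def)
  qed (use assms in auto)
  moreover have "automorphism (pverts G) (parcs G) g" if "g \<in> carrier (Aut G)" for g
    using that by (auto simp: Aut_def Bij_def automorphism_def)
  ultimately show ?thesis unfolding orbit_def by (auto, metis)
qed

text \<open>By \<open>trans\<close> each of \<open>P\<close> and its complement lies in a single
  orbit, by \<open>inv\<close> no orbit meets both, and both are nonempty.\<close>

lemma num_vertex_orbits_eq_2I:
  assumes P: "P \<subset> pverts G" "P \<noteq> {}"
    and trans: "\<And>u v. u \<in> pverts G \<Longrightarrow> v \<in> pverts G \<Longrightarrow> u \<in> P \<longleftrightarrow> v \<in> P \<Longrightarrow>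
      \<exists>f. automorphism (pverts G) (parcs G) f \<and> f u = v"
    and inv: "\<And>f u. automorphism (pverts G) (parcs G) f \<Longrightarrow> u \<in> pverts G \<Longrightarrow> f u \<in> P \<longleftrightarrow> u \<in> P"
  shows "num_vertex_orbits G = 2"
proof -
  have f_in: "f u \<in> pverts G" if "automorphism (pverts G) (parcs G) f" "u \<in> pverts G" for f u
    using that by (auto simp: automorphism_def bij_betw_def)
  have orb: "orbit (Aut G) (\<lambda>f. f) u = (if u \<in> P then P else pverts G - P)" if u: "u \<in> pverts G" for u
  proof -
    have "{f u | f. automorphism (pverts G) (parcs G) f} = {v \<in> pverts G. u \<in> P \<longleftrightarrow> v \<in> P}"
    proof (intro equalityI subsetI)
      fix v assume "v \<in> {f u | f. automorphism (pverts G) (parcs G) f}"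
      then show "v \<in> {v \<in> pverts G. u \<in> P \<longleftrightarrow> v \<in> P}" using u f_in inv by auto
    next
      fix v assume "v \<in> {v \<in> pverts G. u \<in> P \<longleftrightarrow> v \<in> P}"
      then show "v \<in> {f u | f. automorphism (pverts G) (parcs G) f}"
        using trans[OF u, of v] by auto
    qed
    then show ?thesis using P u by (auto simp: orbit_Aut)
  qed
  have "orbits (Aut G) (pverts G) (\<lambda>f. f) = {P, pverts G - P}"
    unfolding orbits_def using P by (auto simp: orb split: if_splits) (metis orb subsetD DiffD1 DiffD2)+
  moreover have "P \<noteq> pverts G - P" using P by auto
  ultimately show ?thesis by (simp add: num_vertex_orbits_def)
qed

text \<open>Serves a relabelling of the vertices in both directions: with \<open>h\<close> and its
  inverse \<open>k\<close> interchanged it carries automorphisms back.\<close>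

lemma automorphism_conjugate:
  assumes h: "bij_betw h W V" and k: "bij_betw k V W"
    and kh: "\<And>w. w \<in> W \<Longrightarrow> k (h w) = w"
    and E': "\<And>u v. u \<in> W \<Longrightarrow> v \<in> W \<Longrightarrow> (u, v) \<in> E' \<longleftrightarrow> (h u, h v) \<in> E"
    and f: "automorphism V E f"
  shows "automorphism W E' (k \<circ> f \<circ> h)"
proof -
  have hk: "h (k v) = v" if "v \<in> V" for v
    using h kh that by (metis bij_betw_iff_bijections)
  have bij: "bij_betw f V V" using f by (simp add: automorphism_def)
  have "bij_betw (k \<circ> f \<circ> h) W W"
    using bij_betw_trans[OF bij_betw_trans[OF h bij] k] by (simp add: comp_assoc)
  moreover have "(k (f (h u)), k (f (h v))) \<in> E' \<longleftrightarrow> (u, v) \<in> E'" if "u \<in> W" "v \<in> W" for u v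
  proof -
    have *: "h u \<in> V" "h v \<in> V" using h that by (auto simp: bij_betw_def)
    then have **: "f (h u) \<in> V" "f (h v) \<in> V" using bij by (auto simp: bij_betw_def)
    then have "k (f (h u)) \<in> W" "k (f (h v)) \<in> W" using k by (auto simp: bij_betw_def)
    then show ?thesis using f * ** that by (simp add: E' hk automorphism_def)
  qed
  ultimately show ?thesis by (auto simp: automorphism_def)
qed

text \<open>Numbering \<open>V\<close> by a bijection \<open>h\<close> from
  \<open>{..<card V}\<close> transports neighbourhood sums, paths and, by conjugation,
  automorphisms. Constructions can thus use structured vertices such as pairs.\<close>

lemma two_orbit_nut_graph_exists:
  fixes V :: "'a set" and E :: "'a rel" and z :: "'a \<Rightarrow> real"
  assumes fin: "finite V" and E: "E \<subseteq> V \<times> V" "sym E" "irrefl E"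
    and conn: "\<And>u v. u \<in> V \<Longrightarrow> v \<in> V \<Longrightarrow> (u, v) \<in> E\<^sup>*"
    and nz: "\<And>v. v \<in> V \<Longrightarrow> z v \<noteq> 0"
    and ker: "\<And>u. u \<in> V \<Longrightarrow> (\<Sum>v | (u, v) \<in> E. z v) = 0"
    and uniq: "\<And>x :: 'a \<Rightarrow> real. (\<And>u. u \<in> V \<Longrightarrow> (\<Sum>v | (u, v) \<in> E. x v) = 0) \<Longrightarrow>
      \<exists>c. \<forall>v\<in>V. x v = c * z v"
    and P: "P \<subset> V" "P \<noteq> {}"
    and trans: "\<And>u v. u \<in> V \<Longrightarrow> v \<in> V \<Longrightarrow> u \<in> P \<longleftrightarrow> v \<in> P \<Longrightarrow>
      \<exists>f. automorphism V E f \<and> f u = v"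
    and inv: "\<And>f u. automorphism V E f \<Longrightarrow> u \<in> V \<Longrightarrow> f u \<in> P \<longleftrightarrow> u \<in> P"
  shows "\<exists>G :: nat pair_pre_digraph.
    nut_graph G \<and> card (pverts G) = card V \<and> num_vertex_orbits G = 2"
proof -
  let ?n = "card V"
  obtain h where h: "bij_betw h {..<?n} V"
    using ex_bij_betw_nat_finite[OF fin] by (auto simp: lessThan_atLeast0)
  define k where "k = inv_into {..<?n} h"
  have k: "bij_betw k V {..<?n}" using h by (simp add: k_def bij_betw_inv_into)
  have kh: "k (h i) = i" if "i < ?n" for i
    using h that by (simp add: k_def bij_betw_inv_into_left)
  have hk: "h (k v) = v" if "v \<in> V" for v
    using h that by (simp add: k_def bij_betw_inv_into_right)
  have hV: "h i \<in> V" if "i < ?n" for i using h that by (auto simp: bij_betw_def)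
  have kn: "k v < ?n" if "v \<in> V" for v using k that by (auto simp: bij_betw_def)
  define E' where "E' = {(i, j). i < ?n \<and> j < ?n \<and> (h i, h j) \<in> E}"
  have E': "(k u, k v) \<in> E'" if "(u, v) \<in> E" for u v
    using that E(1) kn hk by (auto simp: E'_def)
  define G where "G = \<lparr>pverts = {..<?n}, parcs = E'\<rparr>"
  have G: "pverts G = {..<?n}" "parcs G = E'" by (simp_all add: G_def)
  have "finite E'" by (rule finite_subset[of _ "{..<?n} \<times> {..<?n}"]) (auto simp: E'_def)
  then have graph: "pair_graph G"
    using E by unfold_locales
      (auto simp: G E'_def symmetric_def sym_def irrefl_def)
  have sums: "(\<Sum>j | (i, j) \<in> E'. x j) = (\<Sum>v | (h i, v) \<in> E. x (k v))" if "i < ?n" for i and x :: "nat \<Rightarrow> real"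
    using that E(1) hV kn
    by (intro sum.reindex_bij_witness[of _ k h]) (auto simp: E'_def kh hk)
  have "nut_graph G"
  proof (rule nut_graph_natI[OF graph G(1)])
    fix i j assume ij: "i < ?n" "j < ?n"
    have "(k u, k v) \<in> E'\<^sup>*" if "(u, v) \<in> E\<^sup>*" for u v
      using that by (induction rule: rtrancl_induct) (auto intro: rtrancl_into_rtrancl E')
    from this[OF conn[OF hV hV]] show "(i, j) \<in> (parcs G)\<^sup>*"
      using ij by (simp add: kh G)
  next
    show "card V > 0" using P fin by (auto simp: card_gt_0_iff)
  next
    fix i assume "i < ?n" then show "(z \<circ> h) i \<noteq> 0" using nz hV by simp
  next
    fix i assume i: "i < ?n"
    have "(\<Sum>j | (i, j) \<in> E'. (z \<circ> h) j) = (\<Sum>v | (h i, v) \<in> E. z v)"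
      unfolding sums[OF i] using E(1) hk by (intro sum.cong) auto
    then show "(\<Sum>j | (i, j) \<in> parcs G. (z \<circ> h) j) = 0" using ker hV i by (simp add: G)
  next
    fix x :: "nat \<Rightarrow> real" assume x: "\<And>i. i < ?n \<Longrightarrow> (\<Sum>j | (i, j) \<in> parcs G. x j) = 0"
    have "(\<Sum>v | (u, v) \<in> E. (x \<circ> k) v) = 0" if "u \<in> V" for u
      using x[OF kn[OF that]] sums[OF kn[OF that], of x] that by (simp add: G hk)
    from uniq[OF this] obtain c where "\<forall>v\<in>V. (x \<circ> k) v = c * z v" by blast
    then show "\<exists>c. \<forall>i<?n. x i = c * (z \<circ> h) i"
      using hV kh by (intro exI[of _ c]) (metis comp_apply)
  qed
  moreover
  have memP: "i \<in> k ` P \<longleftrightarrow> h i \<in> P" if "i < ?n" for i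
    using that P(1) hk kh by (auto simp: image_iff) (metis psubsetD)+
  have "num_vertex_orbits G = 2"
  proof (rule num_vertex_orbits_eq_2I[of "k ` P"])
    show "k ` P \<noteq> {}" using P by simp
    have "\<exists>v\<in>V. v \<notin> P" using P by auto
    then show "k ` P \<subset> pverts G"
      using P kn memP hk by (auto simp: G psubset_eq) (metis hk kn memP lessThan_iff)
    fix i j assume "i \<in> pverts G" "j \<in> pverts G" "i \<in> k ` P \<longleftrightarrow> j \<in> k ` P"
    then have ij: "i < ?n" "j < ?n" "h i \<in> P \<longleftrightarrow> h j \<in> P" by (auto simp: G memP)
    obtain f where f: "automorphism V E f" "f (h i) = h j"
      using trans[OF hV[OF ij(1)] hV[OF ij(2)] ij(3)] by blast
    have "automorphism {..<?n} E' (k \<circ> f \<circ> h)"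
      by (rule automorphism_conjugate[OF h k _ _ f(1)]) (auto simp: kh E'_def)
    then show "\<exists>f. automorphism (pverts G) (parcs G) f \<and> f i = j"
      using f(2) ij by (intro exI[of _ "k \<circ> f \<circ> h"]) (simp add: G kh)
  next
    fix f i assume f: "automorphism (pverts G) (parcs G) f" and "i \<in> pverts G"
    then have i: "i < ?n" "f i < ?n" by (auto simp: G automorphism_def bij_betw_def)
    have "automorphism V E (h \<circ> f \<circ> k)"
      by (rule automorphism_conjugate[OF k h _ _ f[unfolded G]]) (use E' in \<open>auto simp: hk E'_def kn\<close>)
    from inv[OF this hV[OF i(1)]] show "f i \<in> k ` P \<longleftrightarrow> i \<in> k ` P"
      using i by (simp add: memP kh)
  qed
  ultimately show ?thesis by (intro exI[of _ G]) (simp add: G)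
qed

section \<open>Neighbourhood sums and harmonic functions on residues\<close>

text \<open>The substitution \<open>d = (j - i) mod m\<close> has the inverse
  \<open>j = (i + d) mod m\<close>.\<close>

lemma sum_circulant:
  fixes m :: int and F :: "int \<Rightarrow> real"
  assumes m: "m > 0" and D: "D \<subseteq> {0..<m}"
  shows "(\<Sum>j | j \<in> {0..<m} \<and> (j - i) mod m \<in> D. F j) = (\<Sum>d\<in>D. F ((i + d) mod m))"
  using m D
  by (intro sum.reindex_bij_witness[of _ "\<lambda>d. (i + d) mod m" "\<lambda>j. (j - i) mod m"])
    (auto simp: mod_simps)

text \<open>Maximum principle: where \<open>X\<close> attains its maximum, it is the average of
  values no larger, so all of these are maximal too. The maximum thus spreads along the step
  \<open>d\<close>, whose multiples reach every residue as \<open>d\<close> is coprime to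
  \<open>m\<close>.\<close>

lemma harmonic_imp_constant:
  fixes m :: int and X :: "int \<Rightarrow> real"
  assumes m: "m > 0" and per: "\<And>i. X (i mod m) = X i"
    and fin: "finite D" and d: "d \<in> D" "coprime d m"
    and harm: "\<And>i. (\<Sum>e\<in>D. X (i + e)) = card D * X i"
  shows "X i = X 0"
proof -
  define M where "M = Max (X ` {0..<m})"
  have "M \<in> X ` {0..<m}" unfolding M_def using m by (intro Max_in) auto
  then obtain i0 where i0: "X i0 = M" by auto
  have le: "X j \<le> M" for j
  proof -
    have "X (j mod m) \<le> M" unfolding M_def using m by (intro Max_ge) auto
    then show ?thesis by (simp add: per)
  qed
  have step: "X (j + d) = M" if "X j = M" for j
  proof -
    have "(\<Sum>e\<in>D. M - X (j + e)) = 0"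
      using harm[of j] that by (simp add: sum_subtractf)
    then have "\<forall>e\<in>D. M - X (j + e) = 0"
      using le fin by (subst (asm) sum_nonneg_eq_0_iff) auto
    then show ?thesis using d by auto
  qed
  have steps: "X (i0 + int k * d) = M" for k
  proof (induction k)
    case (Suc k)
    from step[OF this] show ?case by (simp add: algebra_simps)
  qed (simp add: i0)
  have "X j = M" for j
  proof -
    \<comment> \<open>\<open>y\<close> inverts \<open>d\<close> modulo \<open>m\<close>, so
      \<open>c\<close> counts the steps of length \<open>d\<close> from \<open>i0\<close> to
      \<open>j\<close>; reduction modulo \<open>m\<close> makes it nonnegative, as
      \<open>steps\<close> takes a natural number.\<close>
    obtain y where y: "[d * y = 1] (mod m)"
      using cong_solve_coprime_int[OF d(2)] by blast
    define c where "c = (y * (j - i0)) mod m"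
    have "[i0 + c * d = i0 + y * (j - i0) * d] (mod m)"
      unfolding c_def by (intro cong_add cong_mult cong_refl) (simp add: cong_def)
    also have "i0 + y * (j - i0) * d = i0 + (j - i0) * (d * y)" by simp
    also have "[i0 + (j - i0) * (d * y) = i0 + (j - i0) * 1] (mod m)"
      by (intro cong_add cong_scalar_left cong_refl y)
    finally have "(i0 + c * d) mod m = j mod m" by (simp add: cong_def)
    then have "X j = X (i0 + c * d)" by (metis per)
    also have "c = int (nat c)" using m by (simp add: c_def)
    finally show ?thesis by (simp only: steps)
  qed
  then show ?thesis by simp
qed

lemma bij_betw_rotate:
  fixes m :: int
  assumes "m > 0"
  shows "bij_betw (\<lambda>i. (i + k) mod m) {0..<m} {0..<m}"
  using assms by (intro bij_betw_byWitness[of _ "\<lambda>i. (i - k) mod m"]) (auto simp: mod_simps)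

lemma rotate_eq_iff:
  fixes m :: int
  assumes "m > 0" "i \<in> {0..<m}" "j \<in> {0..<m}"
  shows "(i + k) mod m = (j + k) mod m \<longleftrightarrow> i = j"
  by (rule inj_on_eq_iff[OF bij_betw_imp_inj_on[OF bij_betw_rotate[OF assms(1)]] assms(2,3)])

lemma mod_minus_eq:
  fixes m d :: int
  assumes "0 < d" "d \<le> m"
  shows "- d mod m = m - d"
  using assms by (intro int_mod_pos_eq[of _ _ "-1"]) auto

section \<open>Bicirculant graphs of order 2m with m prime to 3\<close>

text \<open>Two copies of the residues modulo \<open>m\<close>, told apart by a Boolean. Symmetry is
  not built in: it asks that \<open>D b a\<close> consist of the negatives modulo \<open>m\<close>
  of \<open>D a b\<close>.\<close>

definition bicirculant_arcs :: "int \<Rightarrow> (bool \<Rightarrow> bool \<Rightarrow> int set) \<Rightarrow> (bool \<times> int) rel" where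
  "bicirculant_arcs m D = {((a, i), (b, j)).
    i \<in> {0..<m} \<and> j \<in> {0..<m} \<and> (j - i) mod m \<in> D a b}"

text \<open>Lets arcs be tested on arbitrary integer representatives, so that indices such as
  \<open>i - 1\<close> call for no case distinction at the ends.\<close>

lemma bicirculant_arcs_mod_iff:
  assumes "m > 0"
  shows "((a, i mod m), (b, j mod m)) \<in> bicirculant_arcs m D \<longleftrightarrow> (j - i) mod m \<in> D a b"
  using assms by (simp add: bicirculant_arcs_def mod_simps)

lemma sum_bicirculant_arcs:
  fixes x :: "bool \<times> int \<Rightarrow> real"
  assumes m: "m > 0" and D: "\<And>b. D a b \<subseteq> {0..<m}"
  shows "(\<Sum>v | ((a, i mod m), v) \<in> bicirculant_arcs m D. x v) =
    (\<Sum>d\<in>D a True. x (True, (i + d) mod m)) + (\<Sum>d\<in>D a False. x (False, (i + d) mod m))"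
proof -
  let ?N = "\<lambda>b. {j. j \<in> {0..<m} \<and> (j - i) mod m \<in> D a b}"
  have "{v. ((a, i mod m), v) \<in> bicirculant_arcs m D} = Pair True ` ?N True \<union> Pair False ` ?N False"
  proof (rule Set.set_eqI)
    fix v :: "bool \<times> int"
    obtain b j where "v = (b, j)" by (cases v)
    then show "v \<in> {v. ((a, i mod m), v) \<in> bicirculant_arcs m D} \<longleftrightarrow>
        v \<in> Pair True ` ?N True \<union> Pair False ` ?N False"
      using m by (cases b) (auto simp: bicirculant_arcs_def mod_simps)
  qed
  moreover have "finite (?N b)" for b by (rule finite_subset[of _ "{0..<m}"]) auto
  ultimately have "(\<Sum>v | ((a, i mod m), v) \<in> bicirculant_arcs m D. x v) =
      (\<Sum>v\<in>Pair True ` ?N True. x v) + (\<Sum>v\<in>Pair False ` ?N False. x v)"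
    by (simp only:) (intro sum.union_disjoint, auto)
  moreover have "(\<Sum>v\<in>Pair b ` ?N b. x v) = (\<Sum>d\<in>D a b. x (b, (i + d) mod m))" for b
    using sum_circulant[OF m D, of "\<lambda>j. x (b, j)"] by (simp add: sum.reindex inj_on_def)
  ultimately show ?thesis by simp
qed

text \<open>Shifting both classes by the same \<open>k\<close> leaves all differences
  unchanged.\<close>

lemma automorphism_bicirculant_rotate:
  assumes "m > 0"
  shows "automorphism (UNIV \<times> {0..<m}) (bicirculant_arcs m D) (\<lambda>(a, i). (a, (i + k) mod m))"
  using assms unfolding automorphism_def
  by (intro conjI bij_betw_byWitness[of _ "\<lambda>(a, i). (a, (i - k) mod m)"])
    (auto simp: bicirculant_arcs_def mod_simps)

definition every_arc_in_triangle :: "'a rel \<Rightarrow> 'a \<Rightarrow> bool" where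
  "every_arc_in_triangle E u \<longleftrightarrow> (\<forall>v. (u, v) \<in> E \<longrightarrow> (\<exists>w. (u, w) \<in> E \<and> (v, w) \<in> E))"

text \<open>As \<open>f\<close> maps \<open>V\<close> onto itself, quantifiers over \<open>V\<close>
  may run over images under \<open>f\<close>, and arcs between images are arcs between the
  originals.\<close>

lemma automorphism_every_arc_in_triangle:
  assumes f: "automorphism V E f" and E: "E \<subseteq> V \<times> V" and u: "u \<in> V"
  shows "every_arc_in_triangle E (f u) \<longleftrightarrow> every_arc_in_triangle E u"
proof -
  have V: "f ` V = V" using f by (simp add: automorphism_def bij_betw_def)
  have fE: "(f u, f v) \<in> E \<longleftrightarrow> (u, v) \<in> E" if "u \<in> V" "v \<in> V" for u v
    using f that by (simp add: automorphism_def)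
  have "every_arc_in_triangle E x \<longleftrightarrow> (\<forall>v\<in>V. (x, v) \<in> E \<longrightarrow> (\<exists>w\<in>V. (x, w) \<in> E \<and> (v, w) \<in> E))" for x
    unfolding every_arc_in_triangle_def using E by blast
  then have "every_arc_in_triangle E (f u) \<longleftrightarrow>
      (\<forall>v\<in>f ` V. (f u, v) \<in> E \<longrightarrow> (\<exists>w\<in>f ` V. (f u, w) \<in> E \<and> (v, w) \<in> E))"
    by (simp only: V)
  also have "\<dots> \<longleftrightarrow> every_arc_in_triangle E u"
    unfolding every_arc_in_triangle_def using E u fE by (auto 0 4)
  finally show ?thesis .
qed

text \<open>The Boolean is \<^const>\<open>True\<close> for the vertices \<open>u_i\<close> and \<^const>\<open>False\<close> for the \<open>w_i\<close>.\<close>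

definition nut_steps :: "int \<Rightarrow> bool \<Rightarrow> bool \<Rightarrow> int set" where
  "nut_steps m a b =
    (if a then (if b then {1, m - 1} else {0, 1})
     else (if b then {0, m - 1} else {2, m - 2}))"

text \<open>The kernel vector is 1 on the \<open>u_i\<close> and -1 on the \<open>w_i\<close>; each
  vertex has two neighbours in either class. The bound \<open>m >= 5\<close> keeps 1 and
  \<open>m - 1\<close>, and 2 and \<open>m - 2\<close>, distinct. That 3 does not divide
  \<open>m\<close> enters twice: 3 generates the residues, and \<open>m\<close> is not 6.\<close>

lemma bicirculant_nut_graph_exists:
  fixes m :: int
  assumes m: "m \<ge> 5" "\<not> 3 dvd m"
  shows "\<exists>G :: nat pair_pre_digraph.
    nut_graph G \<and> card (pverts G) = nat (2 * m) \<and> num_vertex_orbits G = 2"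
proof -
  let ?V = "UNIV \<times> {0..<m} :: (bool \<times> int) set"
  let ?E = "bicirculant_arcs m (nut_steps m)"
  let ?P = "{True} \<times> {0..<m}"
  have m0: "m > 0" using m by simp
  \<comment> \<open>For \<open>m = 6\<close> there would be triangles \<open>w_i\<close>,
    \<open>w_(i+2)\<close>, \<open>w_(i+4)\<close>, and every edge at every vertex would lie in a
    triangle.\<close>
  have m6: "m \<noteq> 6" using m by auto
  note arc_iff = bicirculant_arcs_mod_iff[OF m0, of _ _ _ _ "nut_steps m"]
  have E: "?E \<subseteq> ?V \<times> ?V" by (auto simp: bicirculant_arcs_def)
  have rep: "\<exists>a i. u = (a, i mod m)" if "u \<in> ?V" for u
  proof -
    have "u = (fst u, snd u mod m)" using that by (cases u) simp
    then show ?thesis by blast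
  qed
  have steps: "nut_steps m a b \<subseteq> {0..<m}" for a b using m by (auto simp: nut_steps_def)
  have sym: "sym ?E"
  proof (rule symI, clarify)
    fix a i b j assume *: "((a, i), (b, j)) \<in> ?E"
    then have "(j - i) mod m \<in> nut_steps m a b" by (simp add: bicirculant_arcs_def)
    \<comment> \<open>Negation modulo \<open>m\<close> preserves \<open>{1, m - 1}\<close> and
      \<open>{2, m - 2}\<close> and takes \<open>{0, 1}\<close> to
      \<open>{0, m - 1}\<close>.\<close>
    moreover have "(i - j) mod m = (if (j - i) mod m = 0 then 0 else m - (j - i) mod m)"
      using zmod_zminus1_eq_if[of "j - i" m] by simp
    ultimately show "((b, j), (a, i)) \<in> ?E"
      using * m by (auto simp: bicirculant_arcs_def nut_steps_def split: if_splits)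
  qed
  have conn0: "((True, 0), (a, i)) \<in> ?E\<^sup>*" if "i \<in> {0..<m}" for a i
  proof -
    \<comment> \<open>Step 1 runs through all \<open>u_i\<close>; step 0 then leads from
      \<open>u_i\<close> to \<open>w_i\<close>.\<close>
    have *: "((True, 0), (True, int k mod m)) \<in> ?E\<^sup>*" for k
    proof (induction k)
      case (Suc k)
      have "((True, int k mod m), (True, (int k + 1) mod m)) \<in> ?E"
        using m by (subst arc_iff) (simp add: nut_steps_def)
      with Suc show ?case by (simp add: add.commute)
    qed simp
    have "((True, i mod m), (False, i mod m)) \<in> ?E"
      by (subst arc_iff) (simp add: nut_steps_def)
    with *[of "nat i"] that show ?thesis
      by (cases a) (auto intro: rtrancl_into_rtrancl)
  qed
  have card_V: "card ?V = nat (2 * m)"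
    using m by (simp add: card_cartesian_product nat_mult_distrib)
  show ?thesis
    unfolding card_V[symmetric]
  proof (rule two_orbit_nut_graph_exists[where P = ?P and E = ?E and z = "\<lambda>(a, i). if a then 1 else -1"])
    show "irrefl ?E" using m by (auto simp: irrefl_def bicirculant_arcs_def nut_steps_def)
    show "?E \<subseteq> ?V \<times> ?V" by (fact E)
    show "(u, v) \<in> ?E\<^sup>*" if "u \<in> ?V" "v \<in> ?V" for u v
    proof -
      have "(u, (True, 0)) \<in> ?E\<^sup>*"
        using conn0[of "snd u" "fst u"] that symD[OF sym_rtrancl[OF sym]] by auto
      also have "((True, 0), v) \<in> ?E\<^sup>*"
        using conn0[of "snd v" "fst v"] that by auto
      finally show ?thesis .
    qed
  next
    fix u assume "u \<in> ?V"
    from rep[OF this] obtain a i where u: "u = (a, i mod m)" by blast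
    show "(\<Sum>v | (u, v) \<in> ?E. (case v of (a, i) \<Rightarrow> if a then 1 else -1) :: real) = 0"
      unfolding u sum_bicirculant_arcs[OF m0 steps] using m by (simp add: nut_steps_def)
  next
    fix x :: "bool \<times> int \<Rightarrow> real"
    assume x: "\<And>u. u \<in> ?V \<Longrightarrow> (\<Sum>v | (u, v) \<in> ?E. x v) = 0"
    define X where "X i = x (True, i mod m)" for i
    define Y where "Y i = x (False, i mod m)" for i
    have per: "X (i mod m) = X i" "Y (i mod m) = Y i" for i by (simp_all add: X_def Y_def)
    \<comment> \<open>By periodicity the steps \<open>m - 1\<close> and \<open>m - 2\<close> act as
      -1 and -2.\<close>
    have shift: "X (i + (m - k)) = X (i - k)" "Y (i + (m - k)) = Y (i - k)" for i k
      using per[of "i + (m - k)"] per[of "i - k"] by (simp_all add: algebra_simps)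
        (metis add.commute add_diff_eq mod_add_self2 diff_add_eq)+
    have eq: "(\<Sum>d\<in>nut_steps m a True. X (i + d)) + (\<Sum>d\<in>nut_steps m a False. Y (i + d)) = 0" for a i
      using x[of "(a, i mod m)"] m0 sum_bicirculant_arcs[OF m0 steps, of x a i]
      by (simp add: X_def Y_def)
    have eqX: "X (i + 1) + X (i - 1) + Y i + Y (i + 1) = 0" for i
      using eq[where a = True and i = i] m by (simp add: nut_steps_def shift)
    have eqY: "Y (i + 2) + Y (i - 2) + X i + X (i - 1) = 0" for i
      using eq[where a = False and i = i] m by (simp add: nut_steps_def shift)
    \<comment> \<open>For \<open>X\<close>, add \<open>eqX\<close> at \<open>i + 2\<close> and
      \<open>i - 2\<close> and subtract \<open>eqY\<close> at \<open>i\<close> and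
      \<open>i + 1\<close>. For \<open>Y\<close>, add \<open>eqY\<close> at \<open>i + 1\<close> and
      \<open>i - 1\<close> and subtract \<open>eqX\<close> at \<open>i\<close> and
      \<open>i - 1\<close>.\<close>
    have harm: "X (i + 3) + X (i - 3) = 2 * X i" "Y (i + 3) + Y (i - 3) = 2 * Y i" for i
      using eqX[of "i + 2"] eqX[of "i - 2"] eqY[of i] eqY[of "i + 1"]
        eqX[of i] eqX[of "i - 1"] eqY[of "i - 1"]
      by (simp_all add: algebra_simps)
    have cop: "coprime 3 m" using m by (intro prime_imp_coprime) auto
    have const: "X i = X 0" "Y i = Y 0" for i
      by (rule harmonic_imp_constant[where X = X and D = "{3, -3}", OF m0 per(1) _ _ cop],
          simp_all add: harm)
        (rule harmonic_imp_constant[where X = Y and D = "{3, -3}", OF m0 per(2) _ _ cop],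
          simp_all add: harm)
    have "Y 0 = - X 0" using eqX[of 0] const(1)[of 1] const(1)[of "-1"] const(2)[of 1] by simp
    then have "\<forall>v\<in>?V. x v = X 0 * (case v of (a, i) \<Rightarrow> if a then 1 else -1)"
      using const by (auto simp: X_def Y_def) (metis mod_pos_pos_trivial)+
    then show "\<exists>c. \<forall>v\<in>?V. x v = c * (case v of (a, i) \<Rightarrow> if a then 1 else -1)" ..
  next
    fix u v assume "u \<in> ?V" "v \<in> ?V" "u \<in> ?P \<longleftrightarrow> v \<in> ?P"
    then obtain a i j where "u = (a, i)" "v = (a, j)" "j \<in> {0..<m}" by (cases u; cases v) auto
    then show "\<exists>f. automorphism ?V ?E f \<and> f u = v"
      using automorphism_bicirculant_rotate[OF m0, of "nut_steps m" "j - i"]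
      by (intro exI[of _ "\<lambda>(a, l). (a, (l + (j - i)) mod m)"] conjI) simp_all
  next
    fix f u assume f: "automorphism ?V ?E f" and u: "u \<in> ?V"
    have neg: "-1 mod m = m - 1" "-2 mod m = m - 2" "-3 mod m = m - 3" "-4 mod m = m - 4"
      using m by (simp_all add: mod_minus_eq)
    have tri_True: "every_arc_in_triangle ?E (True, i mod m)" for i
      unfolding every_arc_in_triangle_def
    proof (intro allI impI)
      fix v assume v: "((True, i mod m), v) \<in> ?E"
      then have "v \<in> ?V" using E by blast
      from rep[OF this] obtain b j where vb: "v = (b, j mod m)" by blast
      define d where "d = (j - i) mod m"
      have j: "j mod m = (i + d) mod m" by (simp add: d_def mod_simps)
      have "d \<in> nut_steps m True b" using v by (simp add: vb arc_iff d_def)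
      then consider "v = (True, (i + 1) mod m)" | "v = (True, (i - 1) mod m)"
        | "v = (False, i mod m)" | "v = (False, (i + 1) mod m)"
        using mod_add_self2[of "i - 1" m]
        by (cases b) (auto simp: nut_steps_def vb j algebra_simps)
      then show "\<exists>w. ((True, i mod m), w) \<in> ?E \<and> (v, w) \<in> ?E"
      proof cases
        case 1
        then show ?thesis using m
          by (intro exI[of _ "(False, (i + 1) mod m)"]) (simp add: arc_iff nut_steps_def)
      next
        case 2
        then show ?thesis using m
          by (intro exI[of _ "(False, i mod m)"]) (simp add: arc_iff nut_steps_def)
      next
        case 3
        then show ?thesis using m
          by (intro exI[of _ "(True, (i - 1) mod m)"]) (simp add: arc_iff nut_steps_def neg)
      next
        case 4
        then show ?thesis using m
          by (intro exI[of _ "(True, (i + 1) mod m)"]) (simp add: arc_iff nut_steps_def)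
      qed
    qed
    \<comment> \<open>The edge from \<open>w_i\<close> to \<open>w_(i+2)\<close> lies in no
      triangle: for a common neighbour at difference \<open>d\<close> from \<open>w_i\<close>, both
      \<open>d\<close> and \<open>d - 2\<close> modulo \<open>m\<close> would have to be admissible
      differences to the same class.\<close>
    have tri_False: "\<not> every_arc_in_triangle ?E (False, i mod m)" for i
    proof
      assume "every_arc_in_triangle ?E (False, i mod m)"
      moreover have "((False, i mod m), (False, (i + 2) mod m)) \<in> ?E"
        using m by (simp add: arc_iff nut_steps_def)
      ultimately obtain w where w: "((False, i mod m), w) \<in> ?E" "((False, (i + 2) mod m), w) \<in> ?E"
        unfolding every_arc_in_triangle_def by blast
      then have "w \<in> ?V" using E by blast
      from rep[OF this] obtain b j where wb: "w = (b, j mod m)" by blast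
      define d where "d = (j - i) mod m"
      have "(j - (i + 2)) mod m = (d - 2) mod m" by (simp add: d_def mod_simps algebra_simps)
      then have d: "d \<in> nut_steps m False b" "(d - 2) mod m \<in> nut_steps m False b"
        using w by (simp_all add: wb arc_iff d_def)
      have mods: "(0 - 2) mod m = m - 2" "(m - 1 - 2) mod m = m - 3" "(m - 2 - 2) mod m = m - 4"
        using m by (auto simp: neg mod_pos_pos_trivial)
      obtain e where e: "e = (d - 2) mod m" by blast
      show False
      proof (cases b)
        case True
        then have "d = 0 \<or> d = m - 1" using d by (auto simp: nut_steps_def)
        then have "e = m - 2 \<or> e = m - 3" unfolding e using mods by metis
        with d(2)[folded e] True m show False by (auto simp: nut_steps_def)
      next
        case False
        then have "d = 2 \<or> d = m - 2" using d by (auto simp: nut_steps_def)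
        then have "e = 0 \<or> e = m - 4" unfolding e using mods by (metis mod_0 diff_self)
        \<comment> \<open>The value \<open>m - 4\<close> could be admissible only as 2, that is for
          \<open>m = 6\<close>.\<close>
        with d(2)[folded e] False m m6 show False by (auto simp: nut_steps_def)
      qed
    qed
    have tri: "every_arc_in_triangle ?E v \<longleftrightarrow> v \<in> ?P" if "v \<in> ?V" for v
    proof -
      obtain a i where "v = (a, i mod m)" using rep[OF \<open>v \<in> ?V\<close>] by blast
      then show ?thesis using tri_True tri_False m0 by (cases a) auto
    qed
    have fu: "f u \<in> ?V" using f u by (auto simp: automorphism_def bij_betw_def)
    show "f u \<in> ?P \<longleftrightarrow> u \<in> ?P"
      using automorphism_every_arc_in_triangle[OF f E u] unfolding tri[OF fu] tri[OF u] .
  next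
    have "(False, 0) \<in> ?V" "(False, 0) \<notin> ?P" "(True, 0) \<in> ?P" using m by auto
    then show "?P \<subset> ?V" "?P \<noteq> {}" by blast+
  qed (fact sym | simp split: prod.split)+
qed

section \<open>Circulant graphs with triangles attached\<close>

definition clique_neighbourhood :: "'a rel \<Rightarrow> 'a \<Rightarrow> bool" where
  "clique_neighbourhood E u \<longleftrightarrow>
    (\<forall>v w. (u, v) \<in> E \<longrightarrow> (u, w) \<in> E \<longrightarrow> v \<noteq> w \<longrightarrow> (v, w) \<in> E)"

text \<open>Besides arcs, the property mentions \<open>v \<noteq> w\<close>; injectivity of
  \<open>f\<close> on \<open>V\<close> carries this across.\<close>

lemma automorphism_clique_neighbourhood:
  assumes f: "automorphism V E f" and E: "E \<subseteq> V \<times> V" and u: "u \<in> V"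
  shows "clique_neighbourhood E (f u) \<longleftrightarrow> clique_neighbourhood E u"
proof -
  have V: "f ` V = V" and inj: "inj_on f V" using f by (simp_all add: automorphism_def bij_betw_def)
  have fE: "(f u, f v) \<in> E \<longleftrightarrow> (u, v) \<in> E" if "u \<in> V" "v \<in> V" for u v
    using f that by (simp add: automorphism_def)
  have nbhd: "clique_neighbourhood E x \<longleftrightarrow>
      (\<forall>v\<in>V. \<forall>w\<in>V. (x, v) \<in> E \<longrightarrow> (x, w) \<in> E \<longrightarrow> v \<noteq> w \<longrightarrow> (v, w) \<in> E)" for x
    unfolding clique_neighbourhood_def using E by blast
  then have "clique_neighbourhood E (f u) \<longleftrightarrow> (\<forall>v\<in>f ` V. \<forall>w\<in>f ` V.
      (f u, v) \<in> E \<longrightarrow> (f u, w) \<in> E \<longrightarrow> v \<noteq> w \<longrightarrow> (v, w) \<in> E)"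
    by (simp only: V)
  also have "\<dots> \<longleftrightarrow> clique_neighbourhood E u"
    unfolding nbhd using u by (auto simp: fE inj_on_eq_iff[OF inj])
  finally show ?thesis .
qed

text \<open>
  \<open>(i, None)\<close> is a vertex of the circulant; \<open>(i, Some k)\<close> and \<open>(i, Some (k + t))\<close>, with \<open>k\<close>
  modulo \<open>2 * t\<close>, complete it to one of its triangles.
\<close>

definition bouquet_verts :: "int \<Rightarrow> int \<Rightarrow> (int \<times> int option) set" where
  "bouquet_verts a t = {0..<a} \<times> insert None (Some ` {0..<2 * t})"

text \<open>The steps 1, ..., t and -1, ..., -t, the negative ones reduced modulo
  \<open>a\<close>.\<close>

definition core_steps :: "int \<Rightarrow> int \<Rightarrow> int set" where
  "core_steps a t = {1..t} \<union> {a - t..<a}"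

text \<open>The outer vertices at \<open>i\<close> are matched antipodally modulo
  \<open>2 * t\<close>, so cyclic shifts permute them transitively and preserve the matching. The
  last clause is reached only by mixed pairs.\<close>

fun bouquet_adj :: "int \<Rightarrow> int \<Rightarrow> int \<times> int option \<Rightarrow> int \<times> int option \<Rightarrow> bool" where
  "bouquet_adj a t (i, None) (j, None) \<longleftrightarrow> (j - i) mod a \<in> core_steps a t"
| "bouquet_adj a t (i, Some k) (j, Some l) \<longleftrightarrow> i = j \<and> (l - k) mod (2 * t) = t"
| "bouquet_adj a t (i, _) (j, _) \<longleftrightarrow> i = j"

definition bouquet_arcs :: "int \<Rightarrow> int \<Rightarrow> ((int \<times> int option) \<times> (int \<times> int option)) set" where
  "bouquet_arcs a t =
    {(u, v). u \<in> bouquet_verts a t \<and> v \<in> bouquet_verts a t \<and> bouquet_adj a t u v}"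

lemma bouquet_arcs_simps:
  "((i, None), (j, None)) \<in> bouquet_arcs a t \<longleftrightarrow>
    i \<in> {0..<a} \<and> j \<in> {0..<a} \<and> (j - i) mod a \<in> core_steps a t"
  "((i, None), (j, Some l)) \<in> bouquet_arcs a t \<longleftrightarrow> i \<in> {0..<a} \<and> j = i \<and> l \<in> {0..<2 * t}"
  "((i, Some k), (j, None)) \<in> bouquet_arcs a t \<longleftrightarrow> i \<in> {0..<a} \<and> j = i \<and> k \<in> {0..<2 * t}"
  "((i, Some k), (j, Some l)) \<in> bouquet_arcs a t \<longleftrightarrow>
    i \<in> {0..<a} \<and> j = i \<and> k \<in> {0..<2 * t} \<and> l \<in> {0..<2 * t} \<and> (l - k) mod (2 * t) = t"
  by (auto simp: bouquet_arcs_def bouquet_verts_def)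

lemma sum_bouquet_arcs_core:
  fixes x :: "int \<times> int option \<Rightarrow> real"
  assumes a: "0 \<le> t" "t < a" and i: "i \<in> {0..<a}"
  shows "(\<Sum>v | ((i, None), v) \<in> bouquet_arcs a t. x v) =
    (\<Sum>d\<in>core_steps a t. x ((i + d) mod a, None)) + (\<Sum>l\<in>{0..<2 * t}. x (i, Some l))"
proof -
  let ?N = "{j. j \<in> {0..<a} \<and> (j - i) mod a \<in> core_steps a t}"
  have "{v. ((i, None), v) \<in> bouquet_arcs a t} =
      (\<lambda>j. (j, None)) ` ?N \<union> (\<lambda>l. (i, Some l)) ` {0..<2 * t}"
  proof (rule Set.set_eqI)
    fix v :: "int \<times> int option"
    obtain j q where "v = (j, q)" by (cases v)
    then show "v \<in> {v. ((i, None), v) \<in> bouquet_arcs a t} \<longleftrightarrow>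
        v \<in> (\<lambda>j. (j, None)) ` ?N \<union> (\<lambda>l. (i, Some l)) ` {0..<2 * t}"
      using i by (cases q) (auto simp: bouquet_arcs_simps)
  qed
  moreover have "finite ?N" by (rule finite_subset[of _ "{0..<a}"]) auto
  ultimately have "(\<Sum>v | ((i, None), v) \<in> bouquet_arcs a t. x v) =
      (\<Sum>v\<in>(\<lambda>j. (j, None)) ` ?N. x v) + (\<Sum>v\<in>(\<lambda>l. (i, Some l)) ` {0..<2 * t}. x v)"
    by (simp only:) (intro sum.union_disjoint, auto)
  moreover have "(\<Sum>v\<in>(\<lambda>j. (j, None)) ` ?N. x v) = (\<Sum>d\<in>core_steps a t. x ((i + d) mod a, None))"
    using sum_circulant[of a "core_steps a t" "\<lambda>j. x (j, None)" i] a
    by (simp add: sum.reindex inj_on_def core_steps_def subset_iff)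
  moreover have "(\<Sum>v\<in>(\<lambda>l. (i, Some l)) ` {0..<2 * t}. x v) = (\<Sum>l\<in>{0..<2 * t}. x (i, Some l))"
    by (simp add: sum.reindex inj_on_def)
  ultimately show ?thesis by simp
qed

text \<open>Among the residues modulo \<open>2 * t\<close>, only \<open>(k + t) mod (2 * t)\<close>
  differs from \<open>k\<close> by \<open>t\<close>, so an outer vertex has degree two.\<close>

lemma sum_bouquet_arcs_leaf:
  fixes x :: "int \<times> int option \<Rightarrow> real"
  assumes t: "t > 0" and i: "i \<in> {0..<a}" and k: "k \<in> {0..<2 * t}"
  shows "(\<Sum>v | ((i, Some k), v) \<in> bouquet_arcs a t. x v) =
    x (i, None) + x (i, Some ((k + t) mod (2 * t)))"
proof -
  have partner: "l \<in> {0..<2 * t} \<and> (l - k) mod (2 * t) = t \<longleftrightarrow> l = (k + t) mod (2 * t)" for l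
  proof
    assume l: "l \<in> {0..<2 * t} \<and> (l - k) mod (2 * t) = t"
    then have "(k + t) mod (2 * t) = (k + (l - k) mod (2 * t)) mod (2 * t)" by (simp only:)
    also have "\<dots> = (k + (l - k)) mod (2 * t)" by (rule mod_add_right_eq)
    also have "\<dots> = l" using l by simp
    finally show "l = (k + t) mod (2 * t)" ..
  qed (use t in \<open>simp add: mod_simps\<close>)
  have "{v. ((i, Some k), v) \<in> bouquet_arcs a t} = {(i, None), (i, Some ((k + t) mod (2 * t)))}"
  proof (rule Set.set_eqI)
    fix v :: "int \<times> int option"
    obtain j q where "v = (j, q)" by (cases v)
    then show "v \<in> {v. ((i, Some k), v) \<in> bouquet_arcs a t} \<longleftrightarrow>
        v \<in> {(i, None), (i, Some ((k + t) mod (2 * t)))}"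
      using i k partner by (cases q) (auto simp: bouquet_arcs_simps)
  qed
  then show ?thesis by simp
qed

text \<open>The rotation \<open>r\<close> of the circulant and the rotation \<open>s\<close> of the
  outer vertices are independent, which gives transitivity on each class.\<close>

lemma automorphism_bouquet_rotate:
  assumes "a > 0" "t > 0"
  shows "automorphism (bouquet_verts a t) (bouquet_arcs a t)
    (\<lambda>(i, q). ((i + r) mod a, map_option (\<lambda>l. (l + s) mod (2 * t)) q))"
    (is "automorphism ?V ?E ?f")
  unfolding automorphism_def
proof (intro conjI ballI)
  show "bij_betw ?f ?V ?V"
    by (rule bij_betw_byWitness[of _ "\<lambda>(i, q). ((i - r) mod a, map_option (\<lambda>l. (l - s) mod (2 * t)) q)"])
      (use assms in \<open>auto simp: bouquet_verts_def mod_simps\<close>)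
next
  fix u v assume "u \<in> ?V" "v \<in> ?V"
  moreover obtain i p j q where "u = (i, p)" "v = (j, q)" by (cases u; cases v)
  ultimately show "(?f u, ?f v) \<in> ?E \<longleftrightarrow> (u, v) \<in> ?E"
    using assms rotate_eq_iff[of a j i r]
    by (cases p; cases q) (simp_all add: bouquet_arcs_simps bouquet_verts_def mod_diff_eq image_iff)
qed

text \<open>The vector with value 1 on the circulant and -1 outside is in the kernel: a circulant
  vertex has \<open>2 * t\<close> neighbours of each kind, an outer vertex one of each kind. The
  bound \<open>2 * t < a\<close> keeps the \<open>2 * t\<close> steps distinct.\<close>

lemma bouquet_nut_graph_exists:
  fixes a t :: int
  assumes t: "t > 0" and a: "2 * t < a"
  shows "\<exists>G :: nat pair_pre_digraph.
    nut_graph G \<and> card (pverts G) = nat (a * (2 * t + 1)) \<and> num_vertex_orbits G = 2"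
proof -
  let ?V = "bouquet_verts a t" and ?E = "bouquet_arcs a t"
  let ?P = "{0..<a} \<times> {None} :: (int \<times> int option) set"
  let ?z = "\<lambda>(i, q). if q = None then 1 else - 1 :: real"
  have a0: "a > 0" using t a by simp
  have E: "?E \<subseteq> ?V \<times> ?V" by (auto simp: bouquet_arcs_def)
  have one: "1 \<in> core_steps a t" using t by (simp add: core_steps_def)
  have card_steps: "card (core_steps a t) = nat (2 * t)"
    unfolding core_steps_def using t a by (subst card_Un_disjoint) (auto simp: nat_add_distrib[symmetric])
  have Vcases: "(\<exists>i\<in>{0..<a}. u = (i, None)) \<or> (\<exists>i\<in>{0..<a}. \<exists>k\<in>{0..<2 * t}. u = (i, Some k))"
    if "u \<in> ?V" for u
    using that by (auto simp: bouquet_verts_def)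
  \<comment> \<open>Used with \<open>n = a\<close>, where negation swaps the two halves of
    \<open>core_steps\<close>, and with \<open>n = 2 * t\<close>, where \<open>t\<close> is its own
    negative.\<close>
  have neg: "(i - j) mod n = (if (j - i) mod n = 0 then 0 else n - (j - i) mod n)" for i j n :: int
    using zmod_zminus1_eq_if[of "j - i" n] by simp
  have sym: "sym ?E"
  proof (rule symI)
    fix u v assume *: "(u, v) \<in> ?E"
    obtain i p j q where uv: "u = (i, p)" "v = (j, q)" by (cases u; cases v)
    show "(v, u) \<in> ?E"
    proof (cases p; cases q)
      assume "p = None" "q = None"
      then have ij: "i \<in> {0..<a}" "j \<in> {0..<a}" "(j - i) mod a \<in> core_steps a t"
        using * by (simp_all add: uv bouquet_arcs_simps)
      obtain r where r: "r = (j - i) mod a" by blast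
      then have "r < a" using a0 by simp
      then have "(i - j) mod a \<in> core_steps a t"
        using ij(3) t a unfolding neg[of i j a] r[symmetric] by (auto simp: core_steps_def)
      with ij \<open>p = None\<close> \<open>q = None\<close> show ?thesis by (simp add: uv bouquet_arcs_simps)
    next
      fix k l assume "p = Some k" "q = Some l"
      with * neg[of k l "2 * t"] t show ?thesis by (simp add: uv bouquet_arcs_simps)
    qed (use * in \<open>simp_all add: uv bouquet_arcs_simps\<close>)
  qed
  have conn0: "((0, None), u) \<in> ?E\<^sup>*" if "u \<in> ?V" for u
  proof -
    have *: "((0, None), (int k mod a, None)) \<in> ?E\<^sup>*" for k
    proof (induction k)
      case (Suc k)
      have "((int k mod a, None), ((int k + 1) mod a, None)) \<in> ?E"
        using a0 one t a by (simp add: bouquet_arcs_simps mod_simps)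
      with Suc show ?case by (simp add: add.commute)
    qed simp
    have **: "((0, None), (i, None)) \<in> ?E\<^sup>*" if "i \<in> {0..<a}" for i
      using *[of "nat i"] that by simp
    obtain i q where u: "u = (i, q)" by (cases u)
    then have i: "i \<in> {0..<a}" using that by (simp add: bouquet_verts_def)
    show ?thesis
    proof (cases q)
      case None
      with ** i u show ?thesis by simp
    next
      case (Some k)
      then have "((i, None), u) \<in> ?E" using that u by (auto simp: bouquet_arcs_simps bouquet_verts_def)
      with **[OF i] show ?thesis by (rule rtrancl_into_rtrancl)
    qed
  qed
  have card_V: "card ?V = nat (a * (2 * t + 1))"
    using t a0 by (simp add: bouquet_verts_def card_cartesian_product card_image nat_mult_distrib nat_add_distrib)
  show ?thesis
    unfolding card_V[symmetric]
  proof (rule two_orbit_nut_graph_exists[where P = ?P and E = ?E and z = ?z])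
    show "finite ?V" by (simp add: bouquet_verts_def)
    show "irrefl ?E"
      using t a by (auto simp: irrefl_def bouquet_arcs_def core_steps_def elim!: bouquet_adj.elims)
    show "(u, v) \<in> ?E\<^sup>*" if "u \<in> ?V" "v \<in> ?V" for u v
      using symD[OF sym_rtrancl[OF sym] conn0[OF that(1)]] conn0[OF that(2)] by (rule rtrancl_trans)
  next
    fix u assume "u \<in> ?V"
    with Vcases consider i where "i \<in> {0..<a}" "u = (i, None)"
      | i k where "i \<in> {0..<a}" "k \<in> {0..<2 * t}" "u = (i, Some k)" by blast
    then show "(\<Sum>v | (u, v) \<in> ?E. ?z v) = 0"
      using t a by cases (simp_all add: sum_bouquet_arcs_core sum_bouquet_arcs_leaf card_steps)
  next
    fix x :: "int \<times> int option \<Rightarrow> real"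
    assume x: "\<And>u. u \<in> ?V \<Longrightarrow> (\<Sum>v | (u, v) \<in> ?E. x v) = 0"
    \<comment> \<open>The kernel equation at the partner \<open>k\<close> of \<open>l\<close> is the
      one that involves \<open>x (i, Some l)\<close>.\<close>
    have leaf: "x (i, Some l) = - x (i, None)" if i: "i \<in> {0..<a}" and l: "l \<in> {0..<2 * t}" for i l
    proof -
      define k where "k = (l + t) mod (2 * t)"
      have k: "k \<in> {0..<2 * t}" using t by (simp add: k_def)
      have "(k + t) mod (2 * t) = (l + 2 * t) mod (2 * t)" by (simp add: k_def mod_simps algebra_simps)
      also have "\<dots> = l" using l by simp
      finally show ?thesis
        using x[of "(i, Some k)"] sum_bouquet_arcs_leaf[OF t i k, of x] i k
        by (simp add: bouquet_verts_def)
    qed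
    define X where "X i = x (i mod a, None)" for i
    have per: "X (i mod a) = X i" for i by (simp add: X_def)
    \<comment> \<open>The \<open>2 * t\<close> outer vertices at \<open>i\<close> contribute
      \<open>- X i\<close> each, and \<open>2 * t\<close> is also the number of steps.\<close>
    have harm: "(\<Sum>d\<in>core_steps a t. X (i + d)) = card (core_steps a t) * X i" for i
    proof -
      have im: "i mod a \<in> {0..<a}" using a0 by simp
      have "(\<Sum>l\<in>{0..<2 * t}. x (i mod a, Some l)) = (\<Sum>l\<in>{0..<2 * t}. - X i)"
        using leaf[OF im] by (intro sum.cong) (auto simp: X_def)
      then show ?thesis
        using x[of "(i mod a, None)"] sum_bouquet_arcs_core[OF _ _ im, of t x] im t a
        by (simp add: bouquet_verts_def mod_simps card_steps X_def)
    qed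
    \<comment> \<open>The step 1 is coprime to every \<open>a\<close>.\<close>
    have const: "X i = X 0" for i
      by (rule harmonic_imp_constant[where X = X and D = "core_steps a t", OF a0 per _ one _ harm])
        (simp_all add: core_steps_def)
    have core: "x (i, None) = X 0" if "i \<in> {0..<a}" for i
      using const[of i] that by (simp add: X_def)
    have "x v = X 0 * ?z v" if "v \<in> ?V" for v
      using Vcases[OF that] core leaf by auto
    then show "\<exists>c. \<forall>v\<in>?V. x v = c * ?z v" by blast
  next
    fix u v assume uv: "u \<in> ?V" "v \<in> ?V" "u \<in> ?P \<longleftrightarrow> v \<in> ?P"
    obtain i p j q where eq: "u = (i, p)" "v = (j, q)" by (cases u; cases v)
    \<comment> \<open>If \<open>p\<close> and \<open>q\<close> are \<open>None\<close>, then
      \<open>the q - the p\<close> is unspecified, but \<open>map_option\<close> fixes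
      \<open>None\<close> whatever the shift.\<close>
    define f where
      "f = (\<lambda>(l, r). ((l + (j - i)) mod a, map_option (\<lambda>k. (k + (the q - the p)) mod (2 * t)) r))"
    have "automorphism ?V ?E f"
      unfolding f_def by (rule automorphism_bouquet_rotate[OF a0 t])
    moreover have "p = None \<longleftrightarrow> q = None" using uv by (auto simp: eq bouquet_verts_def)
    then have "f u = v"
      using uv(1,2) by (cases p; cases q) (auto simp: f_def eq bouquet_verts_def)
    ultimately show "\<exists>f. automorphism ?V ?E f \<and> f u = v" by (intro exI[of _ f] conjI)
  next
    fix f u assume f: "automorphism ?V ?E f" and u: "u \<in> ?V"
    \<comment> \<open>An outer vertex at \<open>i\<close> and the next circulant vertex are both
      neighbours. They are adjacent only if \<open>(i + 1) mod a = i\<close>, which would put the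
      difference 0 into \<open>core_steps\<close>.\<close>
    have core: "\<not> clique_neighbourhood ?E (i, None)" if i: "i \<in> {0..<a}" for i
    proof
      assume "clique_neighbourhood ?E (i, None)"
      moreover have "((i, None), (i, Some 0)) \<in> ?E" using i t by (simp add: bouquet_arcs_simps)
      moreover have step: "((i, None), ((i + 1) mod a, None)) \<in> ?E"
        using i a0 one t a by (simp add: bouquet_arcs_simps mod_simps)
      ultimately have "((i, Some 0), ((i + 1) mod a, None)) \<in> ?E"
        unfolding clique_neighbourhood_def by blast
      then have "(i + 1) mod a = i" by (simp add: bouquet_arcs_simps)
      with step show False using t a by (simp add: bouquet_arcs_simps core_steps_def)
    qed
    \<comment> \<open>The neighbours are the circulant vertex at \<open>i\<close>, adjacent to all
      outer vertices there, and a unique partner; two outer neighbours therefore coincide.\<close>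
    have leaf: "clique_neighbourhood ?E (i, Some k)" for i k
      unfolding clique_neighbourhood_def
    proof (intro allI impI)
      fix v w assume *: "((i, Some k), v) \<in> ?E" "((i, Some k), w) \<in> ?E" "v \<noteq> w"
      obtain j p l q where vw: "v = (j, p)" "w = (l, q)" by (cases v; cases w)
      show "(v, w) \<in> ?E"
      proof (cases p; cases q)
        fix r s assume pq: "p = Some r" "q = Some s"
        then have "r \<in> {0..<2 * t}" "s \<in> {0..<2 * t}" "(r + - k) mod (2 * t) = (s + - k) mod (2 * t)"
          using *(1,2) by (simp_all add: vw bouquet_arcs_simps)
        then have "r = s" using rotate_eq_iff[of "2 * t" r s "- k"] t by simp
        with * show ?thesis by (simp add: vw pq bouquet_arcs_simps)
      qed (use * in \<open>simp_all add: vw bouquet_arcs_simps\<close>)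
    qed
    have clique: "v \<in> ?P \<longleftrightarrow> \<not> clique_neighbourhood ?E v" if "v \<in> ?V" for v
      using Vcases[OF that] core leaf by auto
    have fu: "f u \<in> ?V" using f u by (auto simp: automorphism_def bij_betw_def)
    show "f u \<in> ?P \<longleftrightarrow> u \<in> ?P"
      unfolding clique[OF fu] clique[OF u] automorphism_clique_neighbourhood[OF f E u] ..
  next
    have "(0, Some 0) \<in> ?V" "(0, Some 0) \<notin> ?P" using t a0 by (auto simp: bouquet_verts_def)
    moreover have "?P \<subseteq> ?V" by (auto simp: bouquet_verts_def)
    ultimately show "?P \<subset> ?V" by blast
    show "?P \<noteq> {}" using a0 by auto
  qed (fact E | fact sym | simp split: prod.split)+
qed

section \<open>Choice of a family for each composite order\<close>

theorem theorem22:
  fixes n :: nat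
  assumes "n \<ge> 9" and "\<not> prime n"
  shows "\<exists>G :: nat pair_pre_digraph.
    nut_graph G \<and> card (pverts G) = n \<and> num_vertex_orbits G = 2"
proof -
  have bouquet: ?thesis if n: "n = a * (2 * t + 1)" and t: "t > 0" "2 * t < a" for a t :: nat
    using bouquet_nut_graph_exists[of "int t" "int a"] t unfolding n by (simp add: nat_mult_distrib nat_add_distrib)
  show ?thesis
  proof (cases "even n")
    case True
    then obtain m where m: "n = 2 * m" by blast
    show ?thesis
    proof (cases "3 dvd m")
      case True
      then obtain k where "m = 3 * k" by blast
      \<comment> \<open>Here \<open>n = 2 * k * 3\<close>, with one triangle per vertex of a
        circulant on \<open>2 * k\<close> vertices; \<open>n >= 9\<close> gives
        \<open>k >= 2\<close>, hence \<open>2 < 2 * k\<close>.\<close>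
      with m assms(1) show ?thesis by (intro bouquet[of "2 * k" 1]) auto
    next
      case False
      then have "\<not> 3 dvd int m" by presburger
      \<comment> \<open>From \<open>2 * m >= 9\<close> it follows that
        \<open>m >= 5\<close>.\<close>
      with bicirculant_nut_graph_exists[of "int m"] m assms(1) show ?thesis by (simp add: nat_mult_distrib)
    qed
  next
    case False
    obtain p where p: "p dvd n" "p \<noteq> 1" "p \<noteq> n"
      using assms by (auto simp: prime_nat_iff)
    then obtain q where q: "n = p * q" by blast
    have "\<exists>b c. n = c * b \<and> b \<le> c \<and> b \<noteq> 1"
    proof (cases "p \<le> q")
      case True then show ?thesis using q p by (metis mult.commute)
    next
      \<comment> \<open>Now \<open>q\<close> is the smaller factor, and it is not 1 because
        \<open>p\<close> is not \<open>n\<close>.\<close>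
      case False then show ?thesis using q p by (intro exI[of _ q] exI[of _ p]) auto
    qed
    then obtain b c where bc: "n = c * b" "b \<le> c" "b \<noteq> 1" by blast
    with False have "odd b" by simp
    \<comment> \<open>Since \<open>b\<close> is not 1, \<open>t > 0\<close>; and
      \<open>2 * t + 1 = b <= c\<close> gives \<open>2 * t < c\<close>.\<close>
    then obtain t where "b = 2 * t + 1" by (rule oddE)
    with bc show ?thesis by (intro bouquet[of c t]) auto
  qed
qed

end
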